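(* For $\alpha=(\alpha_0,\alpha_1,\alpha_2)\in\mathbb{R}^3$ let $\mathcal{F}_\alpha$ be the set of all continuously differentiable functions $f:[0,1]\to\mathbb{R}$ with $\int_0^1 x^kf(x)\,dx=\alpha_k$ for $k=0,1,2$, and put $\Delta_0:=6\alpha_2-6\alpha_1+\alpha_0$. Then for every $\alpha\in\mathbb{R}^3$ the optimal length $L$ of $\mathcal{F}_\alpha$ satisfies $$12|\Delta_0|\le L\le 32|\Delta_0|.$$ Moreover, the maximum of $B-A$, taken over all $\alpha\in[-1,1]^3$ and all real $A\le B$ such that $[A,B]\subseteq\mathrm{Range}(f')$ for every $f\in\mathcal{F}_\alpha$, is equal to $156$.
   Context: For a set $\mathcal{F}$ of continuously differentiable functions on $[0,1]$, the optimal length of $\mathcal{F}$ is the largest number $L\ge 0$ such that for every $f\in\mathcal{F}$ there is an interval $[a,b]$ (possibly depending on $f$; $a=b$ allowed) with $b-a=L$ and $[a,b]\subseteq \mathrm{Range}(f')$. Here $\mathrm{Range}(f')=f'([0,1])$. *)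

theory Defs
  imports "HOL-Analysis.Analysis"
begin

text \<open>
  Functions on \<open>[0,1]\<close> are represented by total functions; only their values on \<open>{0..1}\<close>
  are used, and the derivative at the endpoints is one-sided.
\<close>

definition unit_deriv :: "(real \<Rightarrow> real) \<Rightarrow> real \<Rightarrow> real" where
  "unit_deriv f x = vector_derivative f (at x within {0..1})"

definition C1_unit :: "(real \<Rightarrow> real) \<Rightarrow> bool" where
  "C1_unit f \<longleftrightarrow> f differentiable_on {0..1} \<and> continuous_on {0..1} (unit_deriv f)"

definition deriv_range :: "(real \<Rightarrow> real) \<Rightarrow> real set" where
  "deriv_range f = unit_deriv f ` {0..1}"

definition is_maximum :: "real set \<Rightarrow> real \<Rightarrow> bool" where
  "is_maximum S m \<longleftrightarrow> m \<in> S \<and> (\<forall>x\<in>S. x \<le> m)"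

definition is_optimal_length :: "(real \<Rightarrow> real) set \<Rightarrow> real \<Rightarrow> bool" where
  "is_optimal_length F L \<longleftrightarrow>
     is_maximum {l. l \<ge> 0 \<and> (\<forall>f\<in>F. \<exists>a b. b - a = l \<and> {a..b} \<subseteq> deriv_range f)} L"

definition moment_class :: "real \<Rightarrow> real \<Rightarrow> real \<Rightarrow> (real \<Rightarrow> real) set" where
  "moment_class \<alpha>0 \<alpha>1 \<alpha>2 =
     {f. C1_unit f \<and>
         integral {0..1} f = \<alpha>0 \<and>
         integral {0..1} (\<lambda>x. x * f x) = \<alpha>1 \<and>
         integral {0..1} (\<lambda>x. x\<^sup>2 * f x) = \<alpha>2}"

definition Delta0 :: "real \<Rightarrow> real \<Rightarrow> real \<Rightarrow> real" where
  "Delta0 \<alpha>0 \<alpha>1 \<alpha>2 = 6 * \<alpha>2 - 6 * \<alpha>1 + \<alpha>0"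

end

theory Submission
  imports Defs
begin

text \<open>
  Write \<open>g = f'\<close>. Integrating by parts against polynomials \<open>P\<close> with \<open>P 0 = P 1 = 0\<close>, the three
  moment conditions become, up to the additive constant of \<open>f\<close>, the two conditions
  \<open>\<integral> x(1-x) g = m\<close> and \<open>\<integral> x(1-x)(2x-1) g = \<Delta>\<^sub>0\<close>, where \<open>m = 2\<alpha>\<^sub>1 - \<alpha>\<^sub>0\<close>. Adding a constant to
  \<open>g\<close> changes only the first one, so the optimal length is the infimum of the oscillation of
  \<open>g\<close> under the second; since \<open>\<integral> x(1-x)\<bar>2x-1\<bar> = 1/16\<close>, this infimum is \<open>32 \<bar>\<Delta>\<^sub>0\<bar>\<close>, approached by
  continuous approximations of \<open>sgn (2x-1)\<close>. Testing \<open>g\<close> against the nonnegative weights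
  \<open>x(1-x) (1 \<plusminus> (2x-1))\<close> shows that its range always contains the interval with end points
  \<open>6m \<plusminus> 6\<Delta>\<^sub>0\<close>; the functions \<open>x^n\<close> and \<open>(1-x)^n\<close> for large \<open>n\<close> show that no longer interval is
  common to all ranges. Finally \<open>\<bar>\<Delta>\<^sub>0\<bar> \<le> 13\<close> on the cube, with equality at \<open>(1,-1,1)\<close>.
\<close>

section \<open>One-sided derivatives and C1 functions on the unit interval\<close>

lemma C1_unit_has_derivative:
  assumes "C1_unit f" "x \<in> {0..1}"
  shows "(f has_real_derivative unit_deriv f x) (at x within {0..1})"
  using assms
  by (simp add: C1_unit_def unit_deriv_def differentiable_on_def vector_derivative_works
      has_real_derivative_iff_has_vector_derivative)

lemma C1_unit_continuous:
  assumes "C1_unit f"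
  shows "continuous_on {0..1} f"
  using assms by (simp add: C1_unit_def differentiable_imp_continuous_on)

lemma unit_deriv_eq:
  assumes "(f has_real_derivative D) (at x within {0..1})" "x \<in> {0..1}"
  shows "unit_deriv f x = D"
  unfolding unit_deriv_def
  using assms by (intro vector_derivative_within_closed_interval)
    (auto simp: has_real_derivative_iff_has_vector_derivative)

lemma C1_unitI:
  assumes "\<And>x. x \<in> {0..1} \<Longrightarrow> (f has_real_derivative g x) (at x within {0..1})"
    and "continuous_on {0..1} g"
  shows "C1_unit f" "deriv_range f = g ` {0..1}"
proof -
  have eq: "unit_deriv f x = g x" if "x \<in> {0..1}" for x
    by (rule unit_deriv_eq[OF assms(1)[OF that] that])
  show "deriv_range f = g ` {0..1}"
    unfolding deriv_range_def using eq by (rule image_cong[OF refl])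
  have "continuous_on {0..1} (unit_deriv f)"
    using assms(2) by (subst continuous_on_cong[OF refl eq]) auto
  moreover have "f differentiable_on {0..1}"
    unfolding differentiable_on_def
    by (intro ballI differentiableI_vector)
      (use assms(1) in \<open>simp add: has_real_derivative_iff_has_vector_derivative\<close>)
  ultimately show "C1_unit f" by (simp add: C1_unit_def)
qed

section \<open>Moment conditions as conditions on the derivative\<close>

text \<open>The fundamental theorem applied to \<open>P * f\<close>: the boundary terms vanish with
  \<open>P\<close>, so no endpoint value of \<open>f\<close> enters.\<close>

lemma integral_by_parts_vanishing:
  fixes P p :: "real \<Rightarrow> real"
  assumes "C1_unit f"
    and P: "\<And>x. (P has_real_derivative p x) (at x)" "P 0 = 0" "P 1 = 0"
    and p: "continuous_on {0..1} p"
  shows "integral {0..1} (\<lambda>x. P x * unit_deriv f x) = - integral {0..1} (\<lambda>x. p x * f x)"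
proof -
  have "((\<lambda>x. p x * f x + P x * unit_deriv f x) has_integral (P 1 * f 1 - P 0 * f 0)) {0..1}"
  proof (rule fundamental_theorem_of_calculus)
    fix x :: real assume x: "x \<in> {0..1}"
    have "((\<lambda>x. P x * f x) has_real_derivative p x * f x + P x * unit_deriv f x)
        (at x within {0..1})"
      using DERIV_mult[OF has_field_derivative_at_within[OF P(1)]
          C1_unit_has_derivative[OF assms(1) x]]
      by (simp add: mult.commute)
    then show "((\<lambda>x. P x * f x) has_vector_derivative p x * f x + P x * unit_deriv f x)
        (at x within {0..1})"
      by (simp add: has_real_derivative_iff_has_vector_derivative)
  qed simp
  then have "integral {0..1} (\<lambda>x. p x * f x + P x * unit_deriv f x) = 0"
    using P by (simp add: integral_unique)
  moreover have "(\<lambda>x. p x * f x) integrable_on {0..1}"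
    by (intro integrable_continuous_real continuous_intros p C1_unit_continuous assms(1))
  moreover have "continuous_on {0..1} P"
    by (rule DERIV_continuous_on) (rule has_field_derivative_at_within, rule P(1))
  then have "(\<lambda>x. P x * unit_deriv f x) integrable_on {0..1}"
    using assms(1) by (intro integrable_continuous_real continuous_on_mult) (simp_all add: C1_unit_def)
  ultimately show ?thesis by (simp add: integral_add)
qed

text \<open>The two weights have derivatives \<open>1 - 2 * x\<close> and
  \<open>-(6 * x^2 - 6 * x + 1)\<close>, up to sign the shifted Legendre polynomials of degrees 1
  and 2. The second one explains the coefficients of \<open>Delta0\<close>.\<close>

lemma moments_unit_deriv:
  assumes "C1_unit f"
  shows "integral {0..1} (\<lambda>x. x * (1 - x) * unit_deriv f x)
          = 2 * integral {0..1} (\<lambda>x. x * f x) - integral {0..1} f" (is ?first)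
    and "integral {0..1} (\<lambda>x. x * (1 - x) * (2 * x - 1) * unit_deriv f x)
          = Delta0 (integral {0..1} f) (integral {0..1} (\<lambda>x. x * f x))
              (integral {0..1} (\<lambda>x. x\<^sup>2 * f x))" (is ?second)
proof -
  note cont = C1_unit_continuous[OF assms]
  have "f integrable_on {0..1}" "(\<lambda>x. x * f x) integrable_on {0..1}"
    "(\<lambda>x. x\<^sup>2 * f x) integrable_on {0..1}"
    by (intro integrable_continuous_real continuous_intros cont)+
  note hi = this[THEN integrable_integral]
  have "((\<lambda>x. f x - 2 * (x * f x)) has_integral
      (integral {0..1} f - 2 * integral {0..1} (\<lambda>x. x * f x))) {0..1}"
    by (intro has_integral_diff has_integral_mult_right hi)
  then have 1: "integral {0..1} (\<lambda>x. (1 - 2 * x) * f x)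
      = integral {0..1} f - 2 * integral {0..1} (\<lambda>x. x * f x)"
    by (intro integral_unique) (simp add: algebra_simps)
  have "((\<lambda>x. 6 * (x * f x) - 6 * (x\<^sup>2 * f x) - f x) has_integral
      (6 * integral {0..1} (\<lambda>x. x * f x) - 6 * integral {0..1} (\<lambda>x. x\<^sup>2 * f x)
        - integral {0..1} f)) {0..1}"
    by (intro has_integral_diff has_integral_mult_right hi)
  then have 2: "integral {0..1} (\<lambda>x. (6 * x - 6 * x\<^sup>2 - 1) * f x)
      = 6 * integral {0..1} (\<lambda>x. x * f x) - 6 * integral {0..1} (\<lambda>x. x\<^sup>2 * f x)
        - integral {0..1} f"
    by (intro integral_unique) (simp add: algebra_simps)
  have "integral {0..1} (\<lambda>x. x * (1 - x) * unit_deriv f x)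
      = - integral {0..1} (\<lambda>x. (1 - 2 * x) * f x)"
    by (rule integral_by_parts_vanishing[OF assms])
      (auto intro!: derivative_eq_intros continuous_intros)
  then show ?first using 1 by simp
  have "integral {0..1} (\<lambda>x. x * (1 - x) * (2 * x - 1) * unit_deriv f x)
      = - integral {0..1} (\<lambda>x. (6 * x - 6 * x\<^sup>2 - 1) * f x)"
    by (rule integral_by_parts_vanishing[OF assms])
      (auto intro!: derivative_eq_intros continuous_intros simp: power2_eq_square algebra_simps)
  then show ?second using 2 by (simp add: Delta0_def)
qed

text \<open>The passage from the three moments to \<open>\<alpha>0\<close>,
  \<open>2 * \<alpha>1 - \<alpha>0\<close> and \<open>Delta0\<close> is an invertible linear change
  of data. Only the first of these depends on the additive constant of \<open>f\<close>.\<close>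

lemma moment_class_iff:
  "f \<in> moment_class \<alpha>0 \<alpha>1 \<alpha>2 \<longleftrightarrow>
     C1_unit f \<and> integral {0..1} f = \<alpha>0 \<and>
     integral {0..1} (\<lambda>x. x * (1 - x) * unit_deriv f x) = 2 * \<alpha>1 - \<alpha>0 \<and>
     integral {0..1} (\<lambda>x. x * (1 - x) * (2 * x - 1) * unit_deriv f x) = Delta0 \<alpha>0 \<alpha>1 \<alpha>2"
proof (cases "C1_unit f")
  case True
  show ?thesis
    unfolding moments_unit_deriv[OF True] using True
    by (auto simp: moment_class_def Delta0_def)
qed (simp add: moment_class_def)

section \<open>Integrals of the weights\<close>

lemma integrable_continuous_mult:
  fixes w g :: "real \<Rightarrow> real"
  assumes "continuous_on {a..b} w" "continuous_on {a..b} g"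
  shows "(\<lambda>x. w x * g x) integrable_on {a..b}"
  by (intro integrable_continuous_real continuous_intros assms)

lemma has_integral_antiderivI:
  fixes F :: "real \<Rightarrow> real"
  assumes "a \<le> b" "\<And>x. x \<in> {a..b} \<Longrightarrow> (F has_real_derivative f x) (at x)" "F b - F a = I"
  shows "(f has_integral I) {a..b}"
  unfolding assms(3)[symmetric] using assms(1,2)
  by (intro fundamental_theorem_of_calculus)
    (auto simp: has_real_derivative_iff_has_vector_derivative intro: has_vector_derivative_at_within)

lemma weight_integrals:
  "((\<lambda>x. x * (1 - x)) has_integral (1/6 :: real)) {0..1}"
  "((\<lambda>x. x * (1 - x) * (2 * x - 1)) has_integral (0 :: real)) {0..1}"
proof -
  show "((\<lambda>x. x * (1 - x)) has_integral (1/6 :: real)) {0..1}"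
    by (rule has_integral_antiderivI[where F = "\<lambda>x. x^2 / 2 - x^3 / 3"])
      (auto intro!: derivative_eq_intros simp: power2_eq_square algebra_simps)
  show "((\<lambda>x. x * (1 - x) * (2 * x - 1)) has_integral (0 :: real)) {0..1}"
    by (rule has_integral_antiderivI[where F = "\<lambda>x. x^3 - x^4 / 2 - x^2 / 2"])
      (auto intro!: derivative_eq_intros simp: power2_eq_square power3_eq_cube algebra_simps)
qed

text \<open>The factor \<open>2 * x - 1\<close> changes sign at \<open>1/2\<close>, and each half
  contributes \<open>1/32\<close>. This value is the source of the constant 32.\<close>

lemma abs_weight_integral:
  "((\<lambda>x. x * (1 - x) * \<bar>2 * x - 1\<bar>) has_integral (1/16 :: real)) {0..1}"
proof -
  have "((\<lambda>x. x * (1 - x) * (1 - 2 * x)) has_integral (1/32 :: real)) {0..1/2}"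
    by (rule has_integral_antiderivI[where F = "\<lambda>x. x^2 / 2 + x^4 / 2 - x^3"])
      (auto intro!: derivative_eq_intros simp: power2_eq_square power3_eq_cube algebra_simps
        power_divide)
  then have 1: "((\<lambda>x. x * (1 - x) * \<bar>2 * x - 1\<bar>) has_integral (1/32 :: real)) {0..1/2}"
    by (rule has_integral_eq[rotated]) auto
  have "((\<lambda>x. x * (1 - x) * (2 * x - 1)) has_integral (1/32 :: real)) {1/2..1}"
    by (rule has_integral_antiderivI[where F = "\<lambda>x. x^3 - x^4 / 2 - x^2 / 2"])
      (auto intro!: derivative_eq_intros simp: power2_eq_square power3_eq_cube algebra_simps
        power_divide)
  then have 2: "((\<lambda>x. x * (1 - x) * \<bar>2 * x - 1\<bar>) has_integral (1/32 :: real)) {1/2..1}"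
    by (rule has_integral_eq[rotated]) auto
  show ?thesis
    using has_integral_combine[OF _ _ 1 2] by simp
qed

section \<open>Members of the class with prescribed derivative\<close>

text \<open>Converse to the reduction: every continuous \<open>g\<close> satisfying the two integral
  conditions is the derivative of a member, so examples can be built at the level of
  derivatives.\<close>

lemma moment_class_realize:
  assumes g: "continuous_on {0..1} g"
    and "integral {0..1} (\<lambda>x. x * (1 - x) * g x) = 2 * \<alpha>1 - \<alpha>0"
    and "integral {0..1} (\<lambda>x. x * (1 - x) * (2 * x - 1) * g x) = Delta0 \<alpha>0 \<alpha>1 \<alpha>2"
  obtains f where "f \<in> moment_class \<alpha>0 \<alpha>1 \<alpha>2" "deriv_range f = g ` {0..1}"
proof -
  define F where "F = (\<lambda>x. integral {0..x} g)"
  \<comment> \<open>The additive constant is the remaining freedom; it is used to adjust the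
    integral of \<open>f\<close> to \<open>\<alpha>0\<close>.\<close>
  define f where "f = (\<lambda>x. F x + (\<alpha>0 - integral {0..1} F))"
  have F: "(F has_real_derivative g x) (at x within {0..1})" if "x \<in> {0..1}" for x
    unfolding F_def using integral_has_real_derivative[OF g that] .
  have f: "(f has_real_derivative g x) (at x within {0..1})" if "x \<in> {0..1}" for x
    unfolding f_def using F[OF that] by (auto intro!: derivative_eq_intros)
  note C1 = C1_unitI[OF f g]
  have "F integrable_on {0..1}"
    using F by (intro integrable_continuous_real DERIV_continuous_on)
  then have "integral {0..1} f = \<alpha>0"
    unfolding f_def by (subst integral_add) auto
  moreover have "unit_deriv f x = g x" if "x \<in> {0..1}" for x
    by (rule unit_deriv_eq[OF f[OF that] that])
  then have "integral {0..1} (\<lambda>x. w x * unit_deriv f x) = integral {0..1} (\<lambda>x. w x * g x)"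
    for w by (intro integral_cong) simp
  ultimately have "f \<in> moment_class \<alpha>0 \<alpha>1 \<alpha>2"
    using assms(2,3) C1(1) by (simp add: moment_class_iff)
  then show thesis using that C1(2) by blast
qed

text \<open>Scaling a profile \<open>s\<close> by \<open>c\<close> meets the condition on
  \<open>Delta0\<close>. A constant shift then meets the other one without disturbing the first,
  because \<open>x * (1 - x) * (2 * x - 1)\<close> has integral 0.\<close>

lemma moment_class_realize_affine:
  assumes s: "continuous_on {0..1} s"
    and M: "((\<lambda>x. x * (1 - x) * s x) has_integral M) {0..1}"
    and I: "((\<lambda>x. x * (1 - x) * (2 * x - 1) * s x) has_integral I) {0..1}"
    and c: "c * I = Delta0 \<alpha>0 \<alpha>1 \<alpha>2"
  obtains f where "f \<in> moment_class \<alpha>0 \<alpha>1 \<alpha>2"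
    "deriv_range f = (\<lambda>x. 6 * (2 * \<alpha>1 - \<alpha>0 - c * M) + c * s x) ` {0..1}"
proof -
  \<comment> \<open>Solution of \<open>K / 6 + c * M = 2 * \<alpha>1 - \<alpha>0\<close>, where
    \<open>1/6\<close> is the integral of \<open>x * (1 - x)\<close>.\<close>
  define K where "K = 6 * (2 * \<alpha>1 - \<alpha>0 - c * M)"
  have "((\<lambda>x. K * (x * (1 - x)) + c * (x * (1 - x) * s x)) has_integral K * (1/6) + c * M) {0..1}"
    by (intro has_integral_add has_integral_mult_right weight_integrals M)
  then have 1: "integral {0..1} (\<lambda>x. x * (1 - x) * (K + c * s x)) = 2 * \<alpha>1 - \<alpha>0"
    by (intro integral_unique) (simp add: K_def algebra_simps)
  have "((\<lambda>x. K * (x * (1 - x) * (2 * x - 1)) + c * (x * (1 - x) * (2 * x - 1) * s x))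
      has_integral K * 0 + c * I) {0..1}"
    by (intro has_integral_add has_integral_mult_right weight_integrals I)
  then have 2: "integral {0..1} (\<lambda>x. x * (1 - x) * (2 * x - 1) * (K + c * s x)) = Delta0 \<alpha>0 \<alpha>1 \<alpha>2"
    by (intro integral_unique) (simp add: c[symmetric] algebra_simps)
  have "continuous_on {0..1} (\<lambda>x. K + c * s x)"
    by (intro continuous_intros s)
  from moment_class_realize[OF this 1 2] obtain f
    where "f \<in> moment_class \<alpha>0 \<alpha>1 \<alpha>2" "deriv_range f = (\<lambda>x. K + c * s x) ` {0..1}" .
  then show thesis unfolding K_def by (rule that)
qed

section \<open>An interval common to all ranges\<close>

lemma deriv_range_interval:
  assumes "C1_unit f"
  obtains c d where "deriv_range f = {c..d}" "c \<le> d"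
  using continuous_image_closed_interval[of 0 1 "unit_deriv f"] assms
  by (auto simp: C1_unit_def deriv_range_def)

lemma weighted_integral_bounds:
  fixes w g :: "real \<Rightarrow> real"
  assumes w: "continuous_on {0..1} w" "(w has_integral W) {0..1}" "\<And>x. x \<in> {0..1} \<Longrightarrow> 0 \<le> w x"
    and g: "continuous_on {0..1} g" "g ` {0..1} \<subseteq> {c..d}"
  shows "c * W \<le> integral {0..1} (\<lambda>x. w x * g x)" "integral {0..1} (\<lambda>x. w x * g x) \<le> d * W"
proof -
  have hi: "((\<lambda>x. w x * g x) has_integral integral {0..1} (\<lambda>x. w x * g x)) {0..1}"
    by (intro integrable_integral integrable_continuous_mult w g)
  have b: "c * w x \<le> w x * g x" "w x * g x \<le> d * w x" if "x \<in> {0..1}" for x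
  proof -
    have "g x \<in> {c..d}" using g(2) that by blast
    then have "c \<le> g x" "g x \<le> d" by auto
    then show "c * w x \<le> w x * g x" "w x * g x \<le> d * w x"
      using w(3)[OF that] mult_right_mono by (simp_all add: mult.commute mult_left_mono)
  qed
  show "c * W \<le> integral {0..1} (\<lambda>x. w x * g x)"
    by (rule has_integral_le[OF has_integral_mult_right[OF w(2)] hi]) (rule b)
  show "integral {0..1} (\<lambda>x. w x * g x) \<le> d * W"
    by (rule has_integral_le[OF hi has_integral_mult_right[OF w(2)]]) (rule b)
qed

text \<open>For \<open>t = 1\<close> and \<open>t = -1\<close> the weight \<open>?w\<close> is
  \<open>2 * x^2 * (1 - x)\<close> and \<open>2 * x * (1 - x)^2\<close>, each nonnegative of mass
  \<open>1/6\<close>. Hence both end points are weighted means of the derivative, and the range,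
  being an interval, contains everything between them.\<close>

lemma common_interval:
  assumes f: "f \<in> moment_class \<alpha>0 \<alpha>1 \<alpha>2"
  shows "{6 * (2 * \<alpha>1 - \<alpha>0) - 6 * \<bar>Delta0 \<alpha>0 \<alpha>1 \<alpha>2\<bar>..6 * (2 * \<alpha>1 - \<alpha>0) + 6 * \<bar>Delta0 \<alpha>0 \<alpha>1 \<alpha>2\<bar>}
    \<subseteq> deriv_range f"
proof -
  let ?g = "unit_deriv f"
  have C1: "C1_unit f" and m: "integral {0..1} (\<lambda>x. x * (1 - x) * ?g x) = 2 * \<alpha>1 - \<alpha>0"
    and D: "integral {0..1} (\<lambda>x. x * (1 - x) * (2 * x - 1) * ?g x) = Delta0 \<alpha>0 \<alpha>1 \<alpha>2"
    using f by (simp_all add: moment_class_iff)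
  then have g: "continuous_on {0..1} ?g" by (simp add: C1_unit_def)
  obtain c d where cd: "deriv_range f = {c..d}" using deriv_range_interval[OF C1] .
  then have sub: "?g ` {0..1} \<subseteq> {c..d}" by (simp add: deriv_range_def)
  have "c * (1/6) \<le> 2 * \<alpha>1 - \<alpha>0 + t * Delta0 \<alpha>0 \<alpha>1 \<alpha>2 \<and>
      2 * \<alpha>1 - \<alpha>0 + t * Delta0 \<alpha>0 \<alpha>1 \<alpha>2 \<le> d * (1/6)" if t: "\<bar>t\<bar> = 1" for t :: real
  proof -
    let ?w = "\<lambda>x. x * (1 - x) + t * (x * (1 - x) * (2 * x - 1))"
    have w: "(?w has_integral (1/6 + t * 0)) {0..1}"
      by (intro has_integral_add has_integral_mult_right weight_integrals)
    have "0 \<le> ?w x" if "x \<in> {0..1}" for x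
    proof -
      have "0 \<le> 1 + t * (2 * x - 1)" using t that by (cases "t = 1") (auto simp: abs_if split: if_splits)
      then have "0 \<le> x * (1 - x) * (1 + t * (2 * x - 1))" using that by simp
      then show ?thesis by (simp add: algebra_simps)
    qed
    note b = weighted_integral_bounds[OF _ w this g sub]
    have cont: "continuous_on {0..1} ?w" by (intro continuous_intros)
    have "((\<lambda>x. x * (1 - x) * ?g x + t * (x * (1 - x) * (2 * x - 1) * ?g x)) has_integral
        2 * \<alpha>1 - \<alpha>0 + t * Delta0 \<alpha>0 \<alpha>1 \<alpha>2) {0..1}"
      unfolding m[symmetric] D[symmetric]
      by (intro has_integral_add has_integral_mult_right integrable_integral
          integrable_continuous_mult continuous_intros g)
    then have "integral {0..1} (\<lambda>x. ?w x * ?g x) = 2 * \<alpha>1 - \<alpha>0 + t * Delta0 \<alpha>0 \<alpha>1 \<alpha>2"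
      by (intro integral_unique) (simp add: algebra_simps)
    then show ?thesis using b[OF cont] by simp
  qed
  from this[of 1] this[of "-1"] show ?thesis unfolding cd by auto
qed

section \<open>The optimal length\<close>

text \<open>Centred at the midpoint of its range, the derivative is at most
  \<open>(d - c) / 2\<close> in absolute value, and centring leaves the integral defining
  \<open>Delta0\<close> unchanged. So \<open>Delta0\<close> is bounded by
  \<open>(d - c) / 2 * (1/16)\<close>.\<close>

lemma range_length_ge:
  assumes f: "f \<in> moment_class \<alpha>0 \<alpha>1 \<alpha>2" and cd: "deriv_range f = {c..d}"
  shows "32 * \<bar>Delta0 \<alpha>0 \<alpha>1 \<alpha>2\<bar> \<le> d - c"
proof -
  define m where "m = (c + d) / 2"
  let ?g = "unit_deriv f" and ?h = "\<lambda>x. unit_deriv f x - m"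
  let ?W = "\<lambda>x. x * (1 - x) * (2 * x - 1) :: real"
  have C1: "C1_unit f" and D: "integral {0..1} (\<lambda>x. ?W x * ?g x) = Delta0 \<alpha>0 \<alpha>1 \<alpha>2"
    using f by (simp_all add: moment_class_iff)
  then have g: "continuous_on {0..1} ?g" by (simp add: C1_unit_def)
  have "((\<lambda>x. ?W x * ?g x - m * ?W x) has_integral
      Delta0 \<alpha>0 \<alpha>1 \<alpha>2 - m * 0) {0..1}"
    unfolding D[symmetric]
    by (intro has_integral_diff has_integral_mult_right integrable_integral weight_integrals
        integrable_continuous_mult continuous_intros g)
  then have hi: "((\<lambda>x. ?W x * ?h x) has_integral Delta0 \<alpha>0 \<alpha>1 \<alpha>2) {0..1}"
    by (simp add: algebra_simps)
  have "norm (integral {0..1} (\<lambda>x. ?W x * ?h x))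
      \<le> integral {0..1} (\<lambda>x. (d - c) / 2 * (x * (1 - x) * \<bar>2 * x - 1\<bar>))"
  proof (rule integral_norm_bound_integral)
    fix x :: real assume x: "x \<in> {0..1}"
    then have "?g x \<in> {c..d}" using cd by (auto simp: deriv_range_def)
    then have "\<bar>?h x\<bar> \<le> (d - c) / 2" by (auto simp: m_def abs_le_iff field_simps)
    moreover have "\<bar>?W x\<bar> = x * (1 - x) * \<bar>2 * x - 1\<bar>" using x by (simp add: abs_mult)
    ultimately show "norm (?W x * ?h x) \<le> (d - c) / 2 * (x * (1 - x) * \<bar>2 * x - 1\<bar>)"
      using x by (simp only: real_norm_def abs_mult[of "?W x"] mult.commute[of "(d - c) / 2"])
        (intro mult_left_mono; simp)
  qed (use hi abs_weight_integral has_integral_mult_right in \<open>blast+\<close>)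
  also have "\<dots> = (d - c) / 2 * (1/16)"
    by (intro integral_unique has_integral_mult_right abs_weight_integral)
  finally show ?thesis using integral_unique[OF hi] by simp
qed

lemma interval_subset_deriv_range:
  assumes f: "f \<in> moment_class \<alpha>0 \<alpha>1 \<alpha>2" and l: "l \<le> 32 * \<bar>Delta0 \<alpha>0 \<alpha>1 \<alpha>2\<bar>"
  shows "\<exists>a b. b - a = l \<and> {a..b} \<subseteq> deriv_range f"
proof -
  obtain c d where cd: "deriv_range f = {c..d}"
    using f deriv_range_interval[of f] unfolding moment_class_iff by blast
  then have "c + l \<le> d" using range_length_ge[OF f] l by fastforce
  then show ?thesis unfolding cd by (intro exI[of _ c] exI[of _ "c + l"]) auto
qed

text \<open>The function \<open>u / (\<bar>u\<bar> + e)\<close> with \<open>u = 2x - 1\<close> is a continuous approximation of \<open>sgn u\<close>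
  that stays in \<open>[-1,1]\<close>.\<close>

lemma common_length_le:
  assumes l: "0 \<le> l" "\<And>f. f \<in> moment_class \<alpha>0 \<alpha>1 \<alpha>2 \<Longrightarrow> \<exists>a b. b - a = l \<and> {a..b} \<subseteq> deriv_range f"
  shows "l \<le> 32 * \<bar>Delta0 \<alpha>0 \<alpha>1 \<alpha>2\<bar>"
proof -
  let ?D = "Delta0 \<alpha>0 \<alpha>1 \<alpha>2"
  \<comment> \<open>The bound \<open>3/8\<close> is exactly what makes
    \<open>1/16 - e * (1/6)\<close> positive, hence \<open>I\<close> below as well.\<close>
  have bound: "l * (1/16 - e * (1/6)) \<le> 2 * \<bar>?D\<bar>" if e: "0 < e" "e < 3/8" for e :: real
  proof -
    define s where "s = (\<lambda>x::real. (2 * x - 1) / (\<bar>2 * x - 1\<bar> + e))"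
    have pos: "0 < \<bar>u\<bar> + e" for u :: real using e by simp
    have s: "continuous_on {0..1} s"
      unfolding s_def using pos by (intro continuous_intros) (simp add: less_imp_neq[symmetric])
    have s1: "\<bar>s x\<bar> \<le> 1" for x
      unfolding s_def using e pos[of "2 * x - 1"] by (simp add: abs_divide)
    define I where "I = integral {0..1} (\<lambda>x. x * (1 - x) * (2 * x - 1) * s x)"
    have M: "((\<lambda>x. x * (1 - x) * s x) has_integral integral {0..1} (\<lambda>x. x * (1 - x) * s x)) {0..1}"
      and I: "((\<lambda>x. x * (1 - x) * (2 * x - 1) * s x) has_integral I) {0..1}"
      unfolding I_def
      by (intro integrable_integral integrable_continuous_mult continuous_intros s)+
    \<comment> \<open>Replacing the sign of \<open>u\<close> by its approximation costs at most
      \<open>e\<close>; integrated against \<open>x * (1 - x)\<close>, this costs \<open>I\<close>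
      at most \<open>e / 6\<close>.\<close>
    have us: "\<bar>u\<bar> - e \<le> u * (u / (\<bar>u\<bar> + e))" for u :: real
    proof -
      have "(\<bar>u\<bar> - e) * (\<bar>u\<bar> + e) \<le> u * u" by (simp add: algebra_simps)
      then show ?thesis using pos[of u] by (simp add: pos_le_divide_eq)
    qed
    have "1/16 - e * (1/6) \<le> I"
    proof (rule has_integral_le[OF _ I])
      show "((\<lambda>x. x * (1 - x) * \<bar>2 * x - 1\<bar> - e * (x * (1 - x))) has_integral
          1/16 - e * (1/6)) {0..1}"
        by (intro has_integral_diff has_integral_mult_right abs_weight_integral weight_integrals)
      fix x :: real assume x: "x \<in> {0..1}"
      then have "x * (1 - x) * (\<bar>2 * x - 1\<bar> - e) \<le> x * (1 - x) * ((2 * x - 1) * s x)"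
        unfolding s_def by (intro mult_left_mono us) simp
      then show "x * (1 - x) * \<bar>2 * x - 1\<bar> - e * (x * (1 - x)) \<le> x * (1 - x) * (2 * x - 1) * s x"
        by (simp only: mult.assoc[of "x * (1 - x)"] right_diff_distrib[of "x * (1 - x)" _ e]
            mult.commute[of e])
    qed
    then have Ipos: "0 < I" and Ige: "1/16 - e * (1/6) \<le> I" using e by auto
    let ?c = "?D / I"
    have "?c * I = ?D" using Ipos by simp
    from moment_class_realize_affine[OF s M I this]
    obtain K f where f: "f \<in> moment_class \<alpha>0 \<alpha>1 \<alpha>2"
      and r: "deriv_range f = (\<lambda>x. K + ?c * s x) ` {0..1}" by metis
    obtain a b where ab: "b - a = l" "{a..b} \<subseteq> deriv_range f" using l(2)[OF f] by blast
    \<comment> \<open>The range lies within distance \<open>\<bar>?c\<bar>\<close> of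
      \<open>K\<close>, so any interval inside it has length at most
      \<open>2 * \<bar>?D\<bar> / I\<close>.\<close>
    have near: "\<bar>y - K\<bar> \<le> \<bar>?c\<bar>" if "y \<in> deriv_range f" for y
    proof -
      obtain x where "y = K + ?c * s x" using \<open>y \<in> deriv_range f\<close> unfolding r by blast
      moreover have "\<bar>?c\<bar> * \<bar>s x\<bar> \<le> \<bar>?c\<bar>" using s1[of x] by (intro mult_left_le) auto
      ultimately show ?thesis by (simp add: abs_mult)
    qed
    have "a \<in> {a..b}" "b \<in> {a..b}" using ab(1) l(1) by auto
    then have "\<bar>a - K\<bar> \<le> \<bar>?c\<bar>" "\<bar>b - K\<bar> \<le> \<bar>?c\<bar>" using near ab(2) by blast+
    then have "l \<le> 2 * \<bar>?c\<bar>" using ab(1) by linarith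
    then have "l * I \<le> 2 * \<bar>?D\<bar>" using Ipos by (simp add: abs_divide pos_le_divide_eq)
    moreover have "l * (1/16 - e * (1/6)) \<le> l * I" using Ige l(1) by (rule mult_left_mono)
    ultimately show ?thesis by linarith
  qed
  \<comment> \<open>Letting \<open>e\<close> tend to 0 from the right gives
    \<open>l / 16 \<le> 2 * \<bar>?D\<bar>\<close>.\<close>
  have "((\<lambda>e. l * (1/16 - e * (1/6))) \<longlongrightarrow> l * (1/16 - 0 * (1/6))) (at_right 0)"
    by (intro tendsto_intros)
  moreover have "eventually (\<lambda>e. l * (1/16 - e * (1/6)) \<le> 2 * \<bar>?D\<bar>) (at_right 0)"
    unfolding eventually_at_right_field using bound by (intro exI[of _ "3/8"]) auto
  ultimately have "l * (1/16 - 0 * (1/6)) \<le> 2 * \<bar>?D\<bar>"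
    by (intro tendsto_upperbound) auto
  then show ?thesis by simp
qed

text \<open>The admissible lengths form exactly the closed interval from 0 to
  \<open>32 * \<bar>Delta0 \<alpha>0 \<alpha>1 \<alpha>2\<bar>\<close>, so the maximum exists and is
  known exactly.\<close>

theorem optimal_length_moment_class:
  "is_optimal_length (moment_class \<alpha>0 \<alpha>1 \<alpha>2) L \<longleftrightarrow> L = 32 * \<bar>Delta0 \<alpha>0 \<alpha>1 \<alpha>2\<bar>"
proof -
  have "{l. l \<ge> 0 \<and> (\<forall>f\<in>moment_class \<alpha>0 \<alpha>1 \<alpha>2. \<exists>a b. b - a = l \<and> {a..b} \<subseteq> deriv_range f)}
      = {0..32 * \<bar>Delta0 \<alpha>0 \<alpha>1 \<alpha>2\<bar>}"
    using interval_subset_deriv_range common_length_le by auto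
  then show ?thesis
    unfolding is_optimal_length_def is_maximum_def by (auto intro: antisym)
qed

section \<open>Sharpness of the common interval\<close>

text \<open>The first two come from expanding into powers of \<open>x\<close>. The reflection of
  \<open>x\<close> to \<open>1 - x\<close> fixes \<open>x * (1 - x)\<close> and negates
  \<open>2 * x - 1\<close>, which yields the other two.\<close>

lemma power_weight_integrals:
  fixes n :: nat
  shows "((\<lambda>x. x * (1 - x) * x ^ n) has_integral (1 / (real (n+2) * real (n+3)))) {0..1}"
    and "((\<lambda>x. x * (1 - x) * (2 * x - 1) * x ^ n) has_integral
          (real n / (real (n+2) * real (n+3) * real (n+4)))) {0..1}"
    and "((\<lambda>x. x * (1 - x) * (1 - x) ^ n) has_integral (1 / (real (n+2) * real (n+3)))) {0..1}"
    and "((\<lambda>x. x * (1 - x) * (2 * x - 1) * (1 - x) ^ n) has_integral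
          - (real n / (real (n+2) * real (n+3) * real (n+4)))) {0..1}"
proof -
  have pow: "((\<lambda>x. x ^ k) has_integral (1 / real (k+1))) {0..1}" for k
    by (rule has_integral_antiderivI[where F = "\<lambda>x. x ^ Suc k / real (Suc k)"])
      (auto intro!: DERIV_cong[OF DERIV_cdivide[OF DERIV_pow]] simp del: of_nat_Suc power_Suc)
  have "((\<lambda>x. x ^ (n+1) - x ^ (n+2)) has_integral
      (1 / real (n+1+1) - 1 / real (n+2+1))) {0..1}"
    by (intro has_integral_diff pow)
  moreover have "1 / real (n+1+1) - 1 / real (n+2+1) = 1 / (real (n+2) * real (n+3))"
    by (simp add: field_simps)
  ultimately show 1: "((\<lambda>x. x * (1 - x) * x ^ n) has_integral
      (1 / (real (n+2) * real (n+3)))) {0..1}"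
    by (simp add: algebra_simps power_add power2_eq_square)
  have "((\<lambda>x. 3 * x ^ (n+2) - 2 * x ^ (n+3) - x ^ (n+1)) has_integral
      (3 * (1 / real (n+2+1)) - 2 * (1 / real (n+3+1)) - 1 / real (n+1+1))) {0..1}"
    by (intro has_integral_diff has_integral_mult_right pow)
  moreover have "3 * (1 / real (n+2+1)) - 2 * (1 / real (n+3+1)) - 1 / real (n+1+1)
      = real n / (real (n+2) * real (n+3) * real (n+4))"
    by (simp add: divide_simps) (simp add: algebra_simps)
  ultimately show 2: "((\<lambda>x. x * (1 - x) * (2 * x - 1) * x ^ n) has_integral
      (real n / (real (n+2) * real (n+3) * real (n+4)))) {0..1}"
    by (simp add: algebra_simps power_add power2_eq_square power3_eq_cube)
  have refl: "((\<lambda>x. f (1 - x)) has_integral I) {0..1}" if "(f has_integral I) {0..1}"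
    for f :: "real \<Rightarrow> real" and I
    using has_integral_affinity[of f I 0 1 "-1" 1] that by simp
  show "((\<lambda>x. x * (1 - x) * (1 - x) ^ n) has_integral (1 / (real (n+2) * real (n+3)))) {0..1}"
    using refl[OF 1] by (simp add: mult.commute)
  show "((\<lambda>x. x * (1 - x) * (2 * x - 1) * (1 - x) ^ n) has_integral
      - (real n / (real (n+2) * real (n+3) * real (n+4)))) {0..1}"
    using has_integral_neg[OF refl[OF 2]] by (simp add: algebra_simps)
qed

text \<open>The profiles \<open>x ^ n\<close> and \<open>(1 - x) ^ n\<close> concentrate at opposite
  ends of the unit interval. One resulting derivative bounds \<open>A\<close> from below, the other
  bounds \<open>B\<close> from above, and both bounds tend to end points of the interval in
  \<open>common_interval\<close>.\<close>

lemma common_interval_length_le: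
  assumes AB: "A \<le> B" "\<And>f. f \<in> moment_class \<alpha>0 \<alpha>1 \<alpha>2 \<Longrightarrow> {A..B} \<subseteq> deriv_range f"
  shows "B - A \<le> 12 * \<bar>Delta0 \<alpha>0 \<alpha>1 \<alpha>2\<bar>"
proof -
  let ?D = "Delta0 \<alpha>0 \<alpha>1 \<alpha>2" and ?m = "2 * \<alpha>1 - \<alpha>0"
  \<comment> \<open>The factor \<open>1 + 4 / real n\<close> is \<open>(n + 4) / n\<close>, the
    ratio of the two integrals of the profile \<open>x ^ n\<close>.\<close>
  have bound: "B - A \<le> 12 * \<bar>?D\<bar> * (1 + 4 / real n)" if n: "n \<ge> 1" for n
  proof -
    define c where "c = ?D * (real (n+2) * real (n+3) * real (n+4)) / real n"
    have c: "c * (real n / (real (n+2) * real (n+3) * real (n+4))) = ?D"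
      "- c * - (real n / (real (n+2) * real (n+3) * real (n+4))) = ?D"
      using n by (simp_all add: c_def)
    have cM: "c * (1 / (real (n+2) * real (n+3))) = ?D * (1 + 4 / real n)"
      using n unfolding c_def by (simp add: divide_simps)
    obtain f where f: "f \<in> moment_class \<alpha>0 \<alpha>1 \<alpha>2"
      and rf: "deriv_range f = (\<lambda>x. 6 * (?m - ?D * (1 + 4 / real n)) + c * x ^ n) ` {0..1}"
    proof -
      have "continuous_on {0..1} (\<lambda>x::real. x ^ n)" by (intro continuous_intros)
      from moment_class_realize_affine[OF this power_weight_integrals(1,2) c(1)]
      show thesis using that unfolding cM by blast
    qed
    obtain h where h: "h \<in> moment_class \<alpha>0 \<alpha>1 \<alpha>2"
      and rh: "deriv_range h = (\<lambda>x. 6 * (?m + ?D * (1 + 4 / real n)) + - c * (1 - x) ^ n) ` {0..1}"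
    proof -
      have "continuous_on {0..1} (\<lambda>x::real. (1 - x) ^ n)" by (intro continuous_intros)
      from moment_class_realize_affine[OF this power_weight_integrals(3,4) c(2)]
      moreover have "?m - - c * (1 / (real (n+2) * real (n+3))) = ?m + ?D * (1 + 4 / real n)"
        using cM by simp
      ultimately show thesis using that by (simp only:) blast
    qed
    have mem: "A \<in> deriv_range f" "B \<in> deriv_range f" "A \<in> deriv_range h" "B \<in> deriv_range h"
      using AB(1) AB(2)[OF f] AB(2)[OF h] by auto
    show ?thesis
    proof (cases "0 \<le> ?D")
      case True
      then have "0 \<le> c" by (simp add: c_def)
      \<comment> \<open>With \<open>0 \<le> c\<close> the derivative of \<open>f\<close> is least at
        \<open>x = 0\<close> and that of \<open>h\<close> is greatest at \<open>x = 1\<close>; for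
        negative \<open>?D\<close> the two functions exchange roles.\<close>
      then have "6 * (?m - ?D * (1 + 4 / real n)) \<le> A" "B \<le> 6 * (?m + ?D * (1 + 4 / real n))"
        using mem(1,4) unfolding rf rh by auto
      then have "B - A \<le> 12 * (?D * (1 + 4 / real n))" by argo
      then show ?thesis using True by simp
    next
      case False
      then have "c \<le> 0" by (simp add: c_def divide_nonpos_nonneg mult_nonpos_nonneg)
      then have "6 * (?m + ?D * (1 + 4 / real n)) \<le> A" "B \<le> 6 * (?m - ?D * (1 + 4 / real n))"
        using mem(2,3) unfolding rf rh by (auto simp: mult_nonpos_nonneg)
      then have "B - A \<le> - 12 * (?D * (1 + 4 / real n))" by argo
      then show ?thesis using False by simp
    qed
  qed
  have "(\<lambda>n. 12 * \<bar>?D\<bar> * (1 + 4 / real n)) \<longlonglongrightarrow> 12 * \<bar>?D\<bar> * (1 + 0)"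
    by (intro tendsto_intros lim_const_over_n)
  moreover have "eventually (\<lambda>n. B - A \<le> 12 * \<bar>?D\<bar> * (1 + 4 / real n)) sequentially"
    using bound unfolding eventually_sequentially by blast
  ultimately have "B - A \<le> 12 * \<bar>?D\<bar> * (1 + 0)"
    by (intro tendsto_lowerbound) auto
  then show ?thesis by simp
qed

section \<open>The two bounds and the maximum over the cube\<close>

theorem corollary1:
  shows "(\<forall>\<alpha>0 \<alpha>1 \<alpha>2 :: real.
            (\<exists>L. is_optimal_length (moment_class \<alpha>0 \<alpha>1 \<alpha>2) L) \<and>
            (\<forall>L. is_optimal_length (moment_class \<alpha>0 \<alpha>1 \<alpha>2) L \<longrightarrow>
                 12 * \<bar>Delta0 \<alpha>0 \<alpha>1 \<alpha>2\<bar> \<le> L \<and> L \<le> 32 * \<bar>Delta0 \<alpha>0 \<alpha>1 \<alpha>2\<bar>))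
       \<and> is_maximum
           {B - A | A B \<alpha>0 \<alpha>1 \<alpha>2.
              \<alpha>0 \<in> {-1..1} \<and> \<alpha>1 \<in> {-1..1} \<and> \<alpha>2 \<in> {-1..1} \<and> A \<le> B \<and>
              (\<forall>f \<in> moment_class \<alpha>0 \<alpha>1 \<alpha>2. {A..B} \<subseteq> deriv_range f)} 156"
    (is "?optimal \<and> is_maximum ?S 156")
proof
  \<comment> \<open>The optimal length equals the upper bound; the lower bound then follows from
    \<open>12 \<le> 32\<close>.\<close>
  show ?optimal by (simp add: optimal_length_moment_class)
  have D: "Delta0 1 (-1) 1 = 13" by (simp add: Delta0_def)
  \<comment> \<open>Here \<open>2 * \<alpha>1 - \<alpha>0 = -3\<close>, so the common interval has
    centre \<open>-18\<close> and half-length \<open>6 * 13 = 78\<close>.\<close>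
  have "\<forall>f \<in> moment_class 1 (-1) 1. {-96..60} \<subseteq> deriv_range f"
    using common_interval[of _ 1 "-1" 1] by (simp add: D)
  then have "156 \<in> ?S"
    by (intro CollectI exI[of _ "-96"] exI[of _ "60::real"] exI[of _ "1::real"]
        exI[of _ "-1::real"]) (auto intro!: exI[of _ "1::real"])
  moreover have "B - A \<le> 156"
    if "\<alpha>0 \<in> {-1..1}" "\<alpha>1 \<in> {-1..1}" "\<alpha>2 \<in> {-1..1}" "A \<le> B"
      "\<forall>f \<in> moment_class \<alpha>0 \<alpha>1 \<alpha>2. {A..B} \<subseteq> deriv_range f" for A B \<alpha>0 \<alpha>1 \<alpha>2
  proof -
    \<comment> \<open>The coefficients of \<open>Delta0\<close> have absolute values summing to
      \<open>6 + 6 + 1 = 13\<close>, and \<open>12 * 13 = 156\<close>.\<close>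
    have "\<bar>Delta0 \<alpha>0 \<alpha>1 \<alpha>2\<bar> \<le> 13" using that(1-3) by (auto simp: Delta0_def)
    then show ?thesis using common_interval_length_le[of A B \<alpha>0 \<alpha>1 \<alpha>2] that(4,5) by fastforce
  qed
  ultimately show "is_maximum ?S 156" unfolding is_maximum_def by blast
qed

end
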